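(* Let $f: X \to X$ be a pc-map. If $A$ is a non-empty, compact subset of $X$ that is $f$-invariant or $f$-pseudo-invariant and satisfies $A\cap\widetilde X_f\neq\emptyset$, then $$h_{top}(f|_A) = \lim_{\epsilon \to 0} \limsup_{n \to \infty} \frac{\log s_n(A; f, \epsilon)}{n} = \lim_{\epsilon \to 0} \limsup_{n \to \infty} \frac{\log r_n(A; f, \epsilon)}{n},$$ where $s_n(A; f, \epsilon)$ (respectively, $r_n(A; f, \epsilon)$) is the maximal cardinality of $(n, \epsilon)$-separated sets (respectively, minimal cardinality of $(n, \epsilon)$-spanning sets) of $A \cap \widetilde X_f$. Moreover, for the calculation using these (Bowen) formulas, the value of $h_{top}(f|_A)$ does not depend on the metric that generates the induced topology on $A\cap\widetilde X_f$.
   Context: **pc-maps.** Let $X\subset\mathbb R$ be a compact interval with non-empty interior, with the topology induced from $\mathbb R$. A pc-map (piecewise continuous interval map) is a map $f:X\to X$ together with finitely many pairwise disjoint non-empty intervals $X_1,\dots,X_N\subset X$ ($N\ge1$), open in $X$ (the continuity pieces), such that $X=\overline{X_1}\cup\dots\cup\overline{X_N}$, each $f|_{X_i}$ is continuous, and $f$ has finitely many critical points (points where $f$ is not locally invertible or where $f$ is discontinuous) within each continuity piece. The pieces are sorted: if $i<j$ then $x<y$ for all $x\in X_i$, $y\in X_j$. Put $\Delta_f:=\bigcup_{i=1}^N\partial X_i$, where $\partial$ is the boundary within $X$. By convention $f$ is continuous at the endpoints of $X$, and these do not belong to $\Delta_f$. Put $\widetilde X_f:=\bigcap_{n\ge0}f^{-n}(X\setminus\Delta_f)$.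 **Invariance.** $A\subset X$ is $f$-invariant if $f(A)\subset A$. It is $f$-pseudo-invariant if for every $x_0\in A$ the limit of $f(x)$ as $x\to x_0$ either from above or from below exists and belongs to $A$ (at least one of the one-sided limits). **Entropy.** A collection of $X$ is a set $\mathcal C$ of non-empty subsets of $X$; it is a cover of $A\subset X$ if $\mathcal C\ne\emptyset$ and $A\subset\bigcup_{C\in\mathcal C}C$; an $A$-open cover is a cover of $A$ by open sets of $A$ (subspace topology). Put $f^{-j}(\mathcal C):=\{f^{-j}(C):C\in\mathcal C\}\setminus\{\emptyset\}$, $\mathcal C\setminus F:=\{C\setminus F:C\in\mathcal C\}\setminus\{\emptyset\}$, $\bigvee_{j}\mathcal C_j:=\{\bigcap_jC_j: C_j\in\mathcal C_j\ \forall j\}\setminus\{\emptyset\}$, and $\mathcal C^n:=\bigvee_{j=0}^{n-1}f^{-j}(\mathcal C\setminus\Delta_f)$. For non-empty $B$ and a cover $\mathcal C$ of $B$, $\aleph_B(\mathcal C)$ is the least cardinality of a sub-collection of $\mathcal C$ covering $B$. For $A$ compact, $f$-invariant or $f$-pseudo-invariant, with $A\cap\widetilde X_f\ne\emptyset$, $$h_{top}(f|_A,\mathcal C):=\lim_{n\to\infty}\frac{\log\aleph_{A\cap\widetilde X_f}(\mathcal C^n)}{n},\qquad h_{top}(f|_A):=\sup\{h_{top}(f|_A,\mathcal C):\mathcal C\text{ is an }A\text{-open cover}\}.$$ **Separated and spanning sets.** Let $\operatorname{dist}$ be the metric (by default the Euclidean one). A set $E\subset A\cap\widetilde X_f$ is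 $(n,\epsilon)$-separated if for all distinct $x,y\in E$ there is $j\in\{0,\dots,n-1\}$ with $\operatorname{dist}(f^j(x),f^j(y))\ge\epsilon$. It is an $(n,\epsilon)$-spanning set of $A\cap\widetilde X_f$ if for every $x\in A\cap\widetilde X_f$ there is $y\in E$ with $\operatorname{dist}(f^j(x),f^j(y))<\epsilon$ for all $j\in\{0,\dots,n-1\}$.
   Formalization: Metric independence is stated for metrics on the closure of A∩X̃_f generating its Euclidean topology; for metrics given only on A∩X̃_f it fails (identity on [0,1], pieces [0,1/2) and (1/2,1], metric |1/(x−1/2)−1/(y−1/2)|: entropy 0, but infinite separated sets). *)

theory Defs
  imports "HOL-Analysis.Analysis" "HOL-Library.Extended_Nat"
begin

section \<open>Piecewise continuous interval maps\<close>

text \<open>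
  A self-map of \<open>X\<close> is a total function on the reals of which only the values on \<open>X\<close> matter;
  its continuity pieces are \<open>P 1, \<dots>, P N\<close>.
\<close>

definition Disc :: "real set \<Rightarrow> nat \<Rightarrow> (nat \<Rightarrow> real set) \<Rightarrow> real set" where
  "Disc X N P = (\<Union>i\<in>{1..N}. (top_of_set X) frontier_of (P i))"

text \<open>
  Locally invertible is read as injective on a neighbourhood in \<open>X\<close>. Inside a continuity piece
  this is the same, up to the endpoints of \<open>X\<close>, as being a local homeomorphism.
\<close>

definition critical_point :: "real set \<Rightarrow> (real \<Rightarrow> real) \<Rightarrow> real \<Rightarrow> bool" where
  "critical_point X f x \<longleftrightarrow>
     \<not> (\<exists>U. openin (top_of_set X) U \<and> x \<in> U \<and> inj_on f U) \<or> \<not> continuous (at x within X) f"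

definition pc_map :: "real set \<Rightarrow> nat \<Rightarrow> (nat \<Rightarrow> real set) \<Rightarrow> (real \<Rightarrow> real) \<Rightarrow> bool" where
  "pc_map X N P f \<longleftrightarrow>
     compact X \<and> is_interval X \<and> interior X \<noteq> {} \<and>
     f \<in> X \<rightarrow> X \<and>
     N \<ge> 1 \<and>
     (\<forall>i\<in>{1..N}. P i \<noteq> {} \<and> is_interval (P i) \<and> openin (top_of_set X) (P i)) \<and>
     pairwise (\<lambda>i j. disjnt (P i) (P j)) {1..N} \<and>
     X = (\<Union>i\<in>{1..N}. (top_of_set X) closure_of (P i)) \<and>
     (\<forall>i\<in>{1..N}. continuous_on (P i) f) \<and>
     (\<forall>i\<in>{1..N}. finite {x \<in> P i. critical_point X f x}) \<and>
     (\<forall>i\<in>{1..N}. \<forall>j\<in>{1..N}. i < j \<longrightarrow> (\<forall>x\<in>P i. \<forall>y\<in>P j. x < y)) \<and>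
     (\<forall>e\<in>{Inf X, Sup X}. continuous (at e within X) f \<and> e \<notin> Disc X N P)"

definition preim :: "real set \<Rightarrow> (real \<Rightarrow> real) \<Rightarrow> nat \<Rightarrow> real set \<Rightarrow> real set" where
  "preim X f n S = {x \<in> X. (f ^^ n) x \<in> S}"

definition Xtilde :: "real set \<Rightarrow> nat \<Rightarrow> (nat \<Rightarrow> real set) \<Rightarrow> (real \<Rightarrow> real) \<Rightarrow> real set" where
  "Xtilde X N P f = (\<Inter>n. preim X f n (X - Disc X N P))"

definition invariant :: "(real \<Rightarrow> real) \<Rightarrow> real set \<Rightarrow> bool" where
  "invariant f A \<longleftrightarrow> f ` A \<subseteq> A"

text \<open>
  The non-triviality of the filter matters: at an endpoint of \<open>X\<close> one of the two one-sided
  filters is \<open>bot\<close>, along which every function converges to everything.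
\<close>

definition pseudo_invariant :: "real set \<Rightarrow> (real \<Rightarrow> real) \<Rightarrow> real set \<Rightarrow> bool" where
  "pseudo_invariant X f A \<longleftrightarrow>
     (\<forall>x\<in>A. \<exists>F\<in>{at x within (X \<inter> {x<..}), at x within (X \<inter> {..<x})}.
        F \<noteq> bot \<and> (\<exists>l\<in>A. (f \<longlongrightarrow> l) F))"


section \<open>Topological entropy\<close>

definition covers :: "'a set set \<Rightarrow> 'a set \<Rightarrow> bool" where
  "covers C B \<longleftrightarrow> C \<noteq> {} \<and> B \<subseteq> \<Union>C"

definition open_cover :: "real set \<Rightarrow> real set set \<Rightarrow> bool" where
  "open_cover A C \<longleftrightarrow> covers C A \<and> (\<forall>U\<in>C. U \<noteq> {} \<and> openin (top_of_set A) U)"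

definition preim_coll :: "real set \<Rightarrow> (real \<Rightarrow> real) \<Rightarrow> nat \<Rightarrow> real set set \<Rightarrow> real set set" where
  "preim_coll X f j C = preim X f j ` C - {{}}"

definition coll_minus :: "'a set set \<Rightarrow> 'a set \<Rightarrow> 'a set set" where
  "coll_minus C F = (\<lambda>U. U - F) ` C - {{}}"

definition join_coll :: "nat \<Rightarrow> (nat \<Rightarrow> 'a set set) \<Rightarrow> 'a set set" where
  "join_coll n D = {(\<Inter>j<n. c j) | c. \<forall>j<n. c j \<in> D j} - {{}}"

definition refine ::
  "real set \<Rightarrow> nat \<Rightarrow> (nat \<Rightarrow> real set) \<Rightarrow> (real \<Rightarrow> real) \<Rightarrow> real set set \<Rightarrow> nat \<Rightarrow> real set set" where
  "refine X N P f C n = join_coll n (\<lambda>j. preim_coll X f j (coll_minus C (Disc X N P)))"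

definition ecard :: "'a set \<Rightarrow> enat" where
  "ecard S = (if finite S then enat (card S) else \<infinity>)"

definition eln :: "enat \<Rightarrow> ereal" where
  "eln k = (case k of enat m \<Rightarrow> ereal (ln (real m)) | \<infinity> \<Rightarrow> \<infinity>)"

text \<open>Infima of non-empty sets of type \<^typ>\<open>enat\<close> are attained, so this is a least cardinality.\<close>

definition aleph :: "'a set \<Rightarrow> 'a set set \<Rightarrow> enat" where
  "aleph B C = (INF S\<in>{S. S \<subseteq> C \<and> covers S B}. ecard S)"

definition h_top_cover ::
  "real set \<Rightarrow> nat \<Rightarrow> (nat \<Rightarrow> real set) \<Rightarrow> (real \<Rightarrow> real) \<Rightarrow> real set \<Rightarrow> real set set \<Rightarrow> ereal" where
  "h_top_cover X N P f A C =
     lim (\<lambda>n. eln (aleph (A \<inter> Xtilde X N P f) (refine X N P f C n)) / ereal (real n))"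

definition h_top ::
  "real set \<Rightarrow> nat \<Rightarrow> (nat \<Rightarrow> real set) \<Rightarrow> (real \<Rightarrow> real) \<Rightarrow> real set \<Rightarrow> ereal" where
  "h_top X N P f A = (SUP C\<in>{C. open_cover A C}. h_top_cover X N P f A C)"


section \<open>Separated and spanning sets\<close>

text \<open>Below, \<open>B\<close> plays the role of \<open>A \<inter> Xtilde X N P f\<close> and \<open>d\<close> is the metric.\<close>

definition separated ::
  "(real \<Rightarrow> real \<Rightarrow> real) \<Rightarrow> (real \<Rightarrow> real) \<Rightarrow> real set \<Rightarrow> nat \<Rightarrow> real \<Rightarrow> real set \<Rightarrow> bool" where
  "separated d f B n \<epsilon> E \<longleftrightarrow> E \<subseteq> B \<and>
     (\<forall>x\<in>E. \<forall>y\<in>E. x \<noteq> y \<longrightarrow> (\<exists>j<n. d ((f ^^ j) x) ((f ^^ j) y) \<ge> \<epsilon>))"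

definition spanning ::
  "(real \<Rightarrow> real \<Rightarrow> real) \<Rightarrow> (real \<Rightarrow> real) \<Rightarrow> real set \<Rightarrow> nat \<Rightarrow> real \<Rightarrow> real set \<Rightarrow> bool" where
  "spanning d f B n \<epsilon> E \<longleftrightarrow> E \<subseteq> B \<and>
     (\<forall>x\<in>B. \<exists>y\<in>E. \<forall>j<n. d ((f ^^ j) x) ((f ^^ j) y) < \<epsilon>)"

definition max_separated ::
  "(real \<Rightarrow> real \<Rightarrow> real) \<Rightarrow> (real \<Rightarrow> real) \<Rightarrow> real set \<Rightarrow> real \<Rightarrow> nat \<Rightarrow> enat" where
  "max_separated d f B \<epsilon> n = (SUP E\<in>{E. separated d f B n \<epsilon> E}. ecard E)"

definition min_spanning ::
  "(real \<Rightarrow> real \<Rightarrow> real) \<Rightarrow> (real \<Rightarrow> real) \<Rightarrow> real set \<Rightarrow> real \<Rightarrow> nat \<Rightarrow> enat" where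
  "min_spanning d f B \<epsilon> n = (INF E\<in>{E. spanning d f B n \<epsilon> E}. ecard E)"

definition growth_rate :: "(nat \<Rightarrow> enat) \<Rightarrow> ereal" where
  "growth_rate a = limsup (\<lambda>n. eln (a n) / ereal (real n))"

text \<open>
  Both Bowen formulas for \<open>h\<close> with respect to \<open>d\<close>; that the limits exist is part of the claim.
\<close>

definition bowen_formulas ::
  "(real \<Rightarrow> real \<Rightarrow> real) \<Rightarrow> (real \<Rightarrow> real) \<Rightarrow> real set \<Rightarrow> ereal \<Rightarrow> bool" where
  "bowen_formulas d f B h \<longleftrightarrow>
     ((\<lambda>\<epsilon>. growth_rate (max_separated d f B \<epsilon>)) \<longlongrightarrow> h) (at_right 0) \<and>
     ((\<lambda>\<epsilon>. growth_rate (min_spanning d f B \<epsilon>)) \<longlongrightarrow> h) (at_right 0)"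

text \<open>
  A metric \<open>d\<close> on the compact set \<open>closure B\<close> generating the Euclidean topology there; it then
  generates the induced topology on \<open>B\<close> as well. Metrics given only on \<open>B\<close> would not do when
  \<open>B\<close> is not closed: for the identity on \<open>[0,1]\<close> with the pieces \<open>[0,1/2)\<close> and \<open>(1/2,1]\<close>, the
  metric pulled back along \<open>x \<mapsto> 1/(x - 1/2)\<close> induces the usual topology on the complement of
  \<open>1/2\<close> but has infinite separated sets, although the entropy is \<open>0\<close>.
\<close>

definition compatible_metric :: "real set \<Rightarrow> (real \<Rightarrow> real \<Rightarrow> real) \<Rightarrow> bool" where
  "compatible_metric B d \<longleftrightarrow>
     Metric_space (closure B) d \<and> Metric_space.mtopology (closure B) d = top_of_set (closure B)"

end

theory Submission
  imports Defs
begin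

text \<open>
  Put \<open>B = A \<inter> Xtilde X N P f\<close>. No orbit starting in \<open>B\<close> meets the discontinuities, so \<open>f\<close> is
  continuous along it, and a one-sided limit of \<open>f\<close> at a point \<open>x\<close> of \<open>B\<close> can only be \<open>f x\<close>. Hence
  pseudo-invariance is as good as invariance: both give \<open>f ` B \<subseteq> B\<close>. From here on \<open>f\<close> is just a
  self-map of a subset \<open>B\<close> of the compact set \<open>A\<close>, and what replaces the usual continuity arguments
  is that all the covers in sight are covers of the compact set \<open>A\<close> and not only of \<open>B\<close>.

  Write \<open>\<aleph>\<^sub>n(C)\<close>, \<open>s\<^sub>n(\<epsilon>)\<close>, \<open>r\<^sub>n(\<epsilon>)\<close> for the three numbers to be compared. Then \<open>r\<^sub>n(\<epsilon>) \<le> s\<^sub>n(\<epsilon>)\<close>, since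
  a separated set of largest size is spanning; \<open>s\<^sub>n(\<epsilon>) \<le> \<aleph>\<^sub>n(C)\<close> if any two points of \<open>B\<close> in one member
  of \<open>C\<close> are less than \<open>\<epsilon>\<close> apart; and \<open>\<aleph>\<^sub>n(C) \<le> r\<^sub>n(\<epsilon>)\<close> if \<open>\<epsilon>\<close> is a Lebesgue number of \<open>C\<close>. For every
  \<open>\<epsilon>\<close> there is a cover \<open>C\<close> as in the second inequality, and for every \<open>C\<close> an \<open>\<epsilon>\<close> as in the third one.
  Taking growth rates, the supremum over all covers and the limit \<open>\<epsilon> \<rightarrow> 0\<close> are therefore the same
  number. The entropy of a cover is defined as a limit and not as an upper limit; that this limit
  exists follows from Fekete's lemma, because \<open>\<aleph>\<^sub>m\<^sub>+\<^sub>n(C) \<le> \<aleph>\<^sub>m(C) \<aleph>\<^sub>n(C)\<close>.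

  Covers by small sets and Lebesgue numbers exist with respect to every metric that is uniformly
  equivalent to the Euclidean one on \<open>B\<close>. Every metric inducing the Euclidean topology on
  \<open>closure B\<close> is of this kind, because \<open>closure B\<close>, a closed subset of \<open>A\<close>, is compact.
\<close>


section \<open>Fekete's lemma\<close>

text \<open>
  Subtracting \<open>k\<close> as often as possible leaves a remainder below \<open>k\<close>, which contributes a bounded
  amount; so \<open>a n / n\<close> is eventually at most \<open>a k / k + \<epsilon>\<close>, for each \<open>k\<close>.
\<close>

lemma Fekete_convergent:
  fixes a :: "nat \<Rightarrow> real"
  assumes sub: "\<And>m n. 0 < m \<Longrightarrow> a (m + n) \<le> a m + a n" and nonneg: "\<And>n. 0 \<le> a n"
  shows "convergent (\<lambda>n. a n / real n)"
proof -
  define L where "L = (INF n\<in>{0<..}. a n / real n)"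
  have bdd: "bdd_below ((\<lambda>n. a n / real n) ` {0<..})"
    by (rule bdd_belowI2[where m = 0]) (simp add: nonneg)
  have lower: "L \<le> a n / real n" if "n > 0" for n
    unfolding L_def by (rule cINF_lower[OF bdd]) (use that in auto)
  have mult: "a (q * k + r) \<le> real q * a k + a r" if "k > 0" for q k r
  proof (induction q)
    case (Suc q)
    have "a (Suc q * k + r) = a (k + (q * k + r))" by (simp add: algebra_simps)
    also have "\<dots> \<le> a k + a (q * k + r)" by (rule sub[OF that])
    also have "\<dots> \<le> real (Suc q) * a k + a r" using Suc by (simp add: algebra_simps)
    finally show ?case .
  qed simp
  have "(\<lambda>n. a n / real n) \<longlonglongrightarrow> L"
  proof (rule order_tendstoI)
    fix y assume "y < L"
    then show "\<forall>\<^sub>F n in sequentially. y < a n / real n"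
      using less_le_trans[OF _ lower] by (intro eventually_sequentiallyI[of 1]) simp
  next
    fix y assume "L < y"
    then obtain k where k: "k > 0" "a k / real k < y"
      unfolding L_def using cINF_less_iff[OF _ bdd, of y] by auto
    define M where "M = Max (a ` {..<k})"
    have M: "a r \<le> M" if "r < k" for r
      unfolding M_def using that by (intro Max_ge) auto
    have bound: "a n / real n \<le> a k / real k + M / real n" if "n > 0" for n
    proof -
      have "a n \<le> real (n div k) * a k + a (n mod k)"
        using mult[OF k(1), of "n div k" "n mod k"] by simp
      also have "\<dots> \<le> (real n / real k) * a k + M"
        using M[of "n mod k"] k(1) nonneg[of k]
        by (intro add_mono mult_right_mono) (auto simp: of_nat_div_le_of_nat)
      finally show ?thesis using that by (simp add: field_simps)
    qed
    have "(\<lambda>n. a k / real k + M / real n) \<longlonglongrightarrow> a k / real k + 0"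
      by (intro tendsto_intros lim_const_over_n)
    then have "\<forall>\<^sub>F n in sequentially. a k / real k + M / real n < y"
      using k(2) by (auto intro: order_tendstoD)
    then show "\<forall>\<^sub>F n in sequentially. a n / real n < y"
      using eventually_gt_at_top[of 0] by eventually_elim (rule le_less_trans[OF bound])
  qed
  then show ?thesis by (rule convergentI)
qed


section \<open>Cardinalities and growth rates\<close>

lemma eln_mono:
  assumes "1 \<le> k" "k \<le> l" shows "eln k \<le> eln l"
  using assms by (cases k; cases l) (auto simp: eln_def one_enat_def)

lemma growth_rate_mono:
  assumes "\<And>n. 1 \<le> a n" "\<And>n. a n \<le> b n"
  shows "growth_rate a \<le> growth_rate b"
  unfolding growth_rate_def
proof (rule Limsup_mono, rule eventually_mono[OF eventually_gt_at_top[of 0]])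
  fix n :: nat assume "0 < n"
  then show "eln (a n) / ereal (real n) \<le> eln (b n) / ereal (real n)"
    using eln_mono[OF assms] by (intro ereal_divide_right_mono) auto
qed

lemma ecard_ge_1: "S \<noteq> {} \<Longrightarrow> 1 \<le> ecard S"
  by (auto simp: ecard_def one_enat_def Suc_le_eq card_gt_0_iff)

lemma ecard_inj_le:
  assumes "inj_on g E" "g ` E \<subseteq> S" shows "ecard E \<le> ecard S"
  using assms card_inj_on_le[of g E S] inj_on_finite[of g E S] by (auto simp: ecard_def)

lemma ecard_image_le: "ecard (g ` E) \<le> ecard E"
  by (auto simp: ecard_def card_image_le)

lemma aleph_le: "S \<subseteq> C \<Longrightarrow> covers S B \<Longrightarrow> aleph B C \<le> ecard S"
  unfolding aleph_def by (rule INF_lower) auto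

lemma aleph_ge_1: "1 \<le> aleph B C"
  unfolding aleph_def by (rule INF_greatest) (auto simp: covers_def intro: ecard_ge_1)

lemma enat_Inf_attained:
  assumes "Inf K = enat k" shows "enat k \<in> K"
proof -
  have "K \<noteq> {}" using assms by (auto simp: Inf_enat_def)
  then have "Inf K = (LEAST x. x \<in> K)" by (simp add: Inf_enat_def)
  moreover obtain z where "z \<in> K" using \<open>K \<noteq> {}\<close> by blast
  then have "(LEAST x. x \<in> K) \<in> K" by (rule LeastI)
  ultimately show ?thesis using assms by simp
qed

lemma aleph_attained:
  assumes "aleph B C = enat k"
  obtains S where "S \<subseteq> C" "covers S B" "finite S" "card S = k"
proof -
  let ?K = "ecard ` {S. S \<subseteq> C \<and> covers S B}"
  have "Inf ?K = enat k" using assms by (simp add: aleph_def)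
  then have "enat k \<in> ?K" by (rule enat_Inf_attained)
  then show thesis using that by (auto simp: ecard_def split: if_splits)
qed


section \<open>Separated and spanning sets\<close>

lemma max_separated_ge_1:
  assumes "B \<noteq> {}" shows "1 \<le> max_separated d f B \<epsilon> n"
proof -
  obtain b where "b \<in> B" using assms by blast
  then have "separated d f B n \<epsilon> {b}" by (simp add: separated_def)
  then have "ecard {b} \<le> max_separated d f B \<epsilon> n"
    unfolding max_separated_def by (intro SUP_upper) auto
  then show ?thesis by (simp add: ecard_def one_enat_def)
qed

lemma min_spanning_ge_1:
  assumes "B \<noteq> {}" shows "1 \<le> min_spanning d f B \<epsilon> n"
  unfolding min_spanning_def
  by (rule INF_greatest) (use assms in \<open>auto simp: spanning_def intro: ecard_ge_1\<close>)

lemma min_spanning_antimono: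
  assumes "\<epsilon> \<le> \<epsilon>'" shows "min_spanning d f B \<epsilon>' n \<le> min_spanning d f B \<epsilon> n"
  unfolding min_spanning_def
proof (rule INF_superset_mono)
  show "{E. spanning d f B n \<epsilon> E} \<subseteq> {E. spanning d f B n \<epsilon>' E}"
    unfolding spanning_def using less_le_trans[OF _ assms] by blast
qed simp

text \<open>A separated set of largest size is spanning: a point it misses could be added to it.\<close>

lemma min_spanning_le_max_separated:
  assumes inv: "f ` B \<subseteq> B"
    and sym: "\<And>x y. \<lbrakk>x \<in> B; y \<in> B\<rbrakk> \<Longrightarrow> d x y = d y x"
    and refl: "\<And>x. x \<in> B \<Longrightarrow> d x x < \<epsilon>"
  shows "min_spanning d f B \<epsilon> n \<le> max_separated d f B \<epsilon> n"
proof (cases "max_separated d f B \<epsilon> n")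
  case (enat m)
  have le: "ecard E \<le> enat m" if "separated d f B n \<epsilon> E" for E
    unfolding enat[symmetric] max_separated_def by (rule SUP_upper) (use that in auto)
  have fin: "finite E" "card E \<le> m" if "separated d f B n \<epsilon> E" for E
    using le[OF that] by (auto simp: ecard_def split: if_splits)
  have "separated d f B n \<epsilon> {}" by (simp add: separated_def)
  moreover have "\<forall>E. separated d f B n \<epsilon> E \<longrightarrow> card E < Suc m" using fin by (simp add: less_Suc_eq_le)
  ultimately obtain E where E: "separated d f B n \<epsilon> E"
    and max: "\<And>E'. separated d f B n \<epsilon> E' \<Longrightarrow> card E' \<le> card E"
    using ex_has_greatest_nat[of "separated d f B n \<epsilon>" "{}" card "Suc m"]
    by blast
  have EB: "E \<subseteq> B" using E by (simp add: separated_def)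
  have iter: "(f ^^ j) x \<in> B" if "x \<in> B" for j x
    using that inv by (induction j) auto
  have "\<exists>y\<in>E. \<forall>j<n. d ((f ^^ j) x) ((f ^^ j) y) < \<epsilon>" if x: "x \<in> B" for x
  proof (rule ccontr)
    assume "\<not> ?thesis"
    then have far: "\<exists>j<n. \<epsilon> \<le> d ((f ^^ j) x) ((f ^^ j) y)" if "y \<in> E" for y
      using that by (auto simp: not_less)
    then have "x \<notin> E" using refl[OF iter[OF x]] by (auto simp: not_le[symmetric])
    moreover have "separated d f B n \<epsilon> (insert x E)"
      unfolding separated_def
    proof (intro conjI ballI impI)
      fix u v assume uv: "u \<in> insert x E" "v \<in> insert x E" "u \<noteq> v"
      consider "u = x" "v \<in> E" | "u \<in> E" "v = x" | "u \<in> E" "v \<in> E" using uv by blast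
      then show "\<exists>j<n. \<epsilon> \<le> d ((f ^^ j) u) ((f ^^ j) v)"
      proof cases
        case 1 then show ?thesis using far by blast
      next
        case 2 then show ?thesis
          using far[of u] sym iter x EB by (metis subsetD)
      next
        case 3 then show ?thesis using E uv by (auto simp: separated_def)
      qed
    qed (use x EB in auto)
    ultimately show False using max[of "insert x E"] fin[OF E] by simp
  qed
  then have "spanning d f B n \<epsilon> E" using EB by (simp add: spanning_def)
  then have "min_spanning d f B \<epsilon> n \<le> ecard E"
    unfolding min_spanning_def by (intro INF_lower) simp
  then show ?thesis using le[OF E] enat by simp
qed simp


section \<open>Refined covers\<close>

lemma all_less_add_iff:
  fixes m n :: nat
  shows "(\<forall>j<m + n. Q j) \<longleftrightarrow> (\<forall>j<m. Q j) \<and> (\<forall>j<n. Q (j + m))"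
proof (intro iffI conjI allI impI)
  fix j assume *: "(\<forall>j<m. Q j) \<and> (\<forall>j<n. Q (j + m))" "j < m + n"
  show "Q j"
  proof (cases "j < m")
    case False
    then have "j - m < n" using *(2) by simp
    then have "Q (j - m + m)" using *(1) by blast
    then show ?thesis using False by simp
  qed (use * in simp)
qed simp_all

text \<open>
  The intersections that make up a refined cover are non-empty, and then so are the sets
  intersected; hence emptiness need only be ruled out once.
\<close>

lemma mem_refine_iff:
  "V \<in> refine X N P f C n \<longleftrightarrow>
     V \<noteq> {} \<and> (\<exists>U. (\<forall>j<n. U j \<in> C) \<and> V = (\<Inter>j<n. preim X f j (U j - Disc X N P)))"
    (is "_ \<longleftrightarrow> _ \<and> (\<exists>U. _ \<and> V = ?I U)")
proof
  assume "V \<in> refine X N P f C n"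
  then obtain c where ne: "V \<noteq> {}" and V: "V = (\<Inter>j<n. c j)"
    and c: "\<forall>j<n. c j \<in> preim_coll X f j (coll_minus C (Disc X N P))"
    unfolding refine_def join_coll_def by blast
  have "\<exists>U. U \<in> C \<and> c j = preim X f j (U - Disc X N P)" if "j < n" for j
    using c[rule_format, OF that] unfolding preim_coll_def coll_minus_def by blast
  then obtain U where U: "\<forall>j<n. U j \<in> C \<and> c j = preim X f j (U j - Disc X N P)" by metis
  then have "V = ?I U" using V by auto
  then show "V \<noteq> {} \<and> (\<exists>U. (\<forall>j<n. U j \<in> C) \<and> V = ?I U)" using ne U by blast
next
  assume "V \<noteq> {} \<and> (\<exists>U. (\<forall>j<n. U j \<in> C) \<and> V = ?I U)"
  then obtain U where ne: "V \<noteq> {}" and U: "\<forall>j<n. U j \<in> C" and V: "V = ?I U" by blast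
  have "preim X f j (U j - Disc X N P) \<in> preim_coll X f j (coll_minus C (Disc X N P))"
    if "j < n" for j
  proof -
    have "preim X f j (U j - Disc X N P) \<noteq> {}" using ne V that by auto
    then show ?thesis
      using U that unfolding preim_coll_def coll_minus_def preim_def by auto
  qed
  then show "V \<in> refine X N P f C n"
    unfolding refine_def join_coll_def using ne V by blast
qed

text \<open>
  The set \<open>B\<close> stands for \<open>A \<inter> Xtilde X N P f\<close>. Since \<open>B\<close> is invariant and does not meet the
  discontinuities, removing these from the members of a cover does not change which itineraries a
  point of \<open>B\<close> has (\<open>mem_itinerary_iff\<close> below).
\<close>

locale invariant_part =
  fixes X A B :: "real set" and N :: nat and P :: "nat \<Rightarrow> real set" and f :: "real \<Rightarrow> real"
  assumes f_X: "f ` X \<subseteq> X" and A_X: "A \<subseteq> X" and compact_A: "compact A"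
    and B_A: "B \<subseteq> A" and B_Disc: "B \<inter> Disc X N P = {}" and B_ne: "B \<noteq> {}"
    and f_B: "f ` B \<subseteq> B"
begin

lemma iter_B: "x \<in> B \<Longrightarrow> (f ^^ j) x \<in> B"
  using f_B by (induction j) auto

lemma iter_X: "x \<in> X \<Longrightarrow> (f ^^ j) x \<in> X"
  using f_X by (induction j) auto

lemma mem_itinerary_iff:
  assumes "x \<in> B"
  shows "x \<in> (\<Inter>j<n. preim X f j (U j - Disc X N P)) \<longleftrightarrow> (\<forall>j<n. (f ^^ j) x \<in> U j)"
  using assms iter_B[OF assms] B_A A_X B_Disc by (auto simp: preim_def)

text \<open>
  If \<open>S\<close> and \<open>T\<close> are covers by members of the \<open>m\<close>-th and the \<open>n\<close>-th refinement, then the sets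
  \<open>V \<inter> f\<^sup>-\<^sup>m(W)\<close> cover \<open>B\<close>, as \<open>f\<^sup>m\<close> maps \<open>B\<close> into itself. For \<open>m = n = 0\<close> such a set is \<open>X\<close>, whereas
  the only member of the zeroth refinement is the empty intersection \<open>UNIV\<close>.
\<close>

lemma aleph_refine_add_le:
  assumes m: "0 < m"
  shows "aleph B (refine X N P f C (m + n))
     \<le> aleph B (refine X N P f C m) * aleph B (refine X N P f C n)"
proof (cases "aleph B (refine X N P f C m)"; cases "aleph B (refine X N P f C n)")
  fix k l
  assume k: "aleph B (refine X N P f C m) = enat k" and l: "aleph B (refine X N P f C n) = enat l"
  obtain S where S: "S \<subseteq> refine X N P f C m" "covers S B" "finite S" "card S = k"
    using aleph_attained[OF k] .
  obtain T where T: "T \<subseteq> refine X N P f C n" "covers T B" "finite T" "card T = l"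
    using aleph_attained[OF l] .
  define W where "W = (\<lambda>(V, V'). V \<inter> preim X f m V') ` (S \<times> T) - {{}}"
  have "W \<subseteq> refine X N P f C (m + n)"
  proof
    fix Z assume "Z \<in> W"
    then obtain V V' where V: "V \<in> S" "V' \<in> T" "Z = V \<inter> preim X f m V'" and ne: "Z \<noteq> {}"
      unfolding W_def by auto
    obtain U where U: "\<forall>j<m. U j \<in> C" "V = (\<Inter>j<m. preim X f j (U j - Disc X N P))"
      using subsetD[OF S(1) V(1)] unfolding mem_refine_iff by blast
    obtain U' where U': "\<forall>j<n. U' j \<in> C" "V' = (\<Inter>j<n. preim X f j (U' j - Disc X N P))"
      using subsetD[OF T(1) V(2)] unfolding mem_refine_iff by blast
    define U'' where "U'' j = (if j < m then U j else U' (j - m))" for j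
    have "x \<in> Z \<longleftrightarrow> x \<in> (\<Inter>j<m + n. preim X f j (U'' j - Disc X N P))" for x
    proof (cases "x \<in> X")
      case True
      have "x \<in> Z \<longleftrightarrow> (\<forall>j<m. (f ^^ j) x \<in> U'' j - Disc X N P) \<and>
          (\<forall>j<n. (f ^^ (j + m)) x \<in> U'' (j + m) - Disc X N P)"
        using True iter_X[OF True] by (auto simp: V U U' U''_def preim_def funpow_add)
      also have "\<dots> \<longleftrightarrow> (\<forall>j<m + n. (f ^^ j) x \<in> U'' j - Disc X N P)"
        by (rule all_less_add_iff[symmetric])
      also have "\<dots> \<longleftrightarrow> x \<in> (\<Inter>j<m + n. preim X f j (U'' j - Disc X N P))"
        using True by (auto simp: preim_def)
      finally show ?thesis .
    qed (use m in \<open>auto simp: V U preim_def\<close>)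
    then have "Z = (\<Inter>j<m + n. preim X f j (U'' j - Disc X N P))" by blast
    moreover have "\<forall>j<m + n. U'' j \<in> C" using U(1) U'(1) by (auto simp: U''_def)
    ultimately show "Z \<in> refine X N P f C (m + n)" using ne by (auto simp: mem_refine_iff)
  qed
  moreover have "covers W B"
  proof -
    have "x \<in> \<Union>W" if x: "x \<in> B" for x
    proof -
      obtain V where "V \<in> S" "x \<in> V" using S(2) x by (auto simp: covers_def)
      moreover obtain V' where "V' \<in> T" "(f ^^ m) x \<in> V'"
        using T(2) iter_B[OF x, of m] by (auto simp: covers_def)
      moreover have "x \<in> X" using x B_A A_X by auto
      ultimately have "x \<in> V \<inter> preim X f m V'" "V \<inter> preim X f m V' \<in> W"
        by (auto simp: W_def preim_def)
      then show ?thesis by blast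
    qed
    then show ?thesis using B_ne by (auto simp: covers_def)
  qed
  ultimately have "aleph B (refine X N P f C (m + n)) \<le> ecard W" by (rule aleph_le)
  also have "\<dots> \<le> enat (k * l)"
  proof -
    have fin: "finite (S \<times> T)" using S T by simp
    have "card W \<le> card ((\<lambda>(V, V'). V \<inter> preim X f m V') ` (S \<times> T))"
      unfolding W_def using fin by (intro card_mono) auto
    also have "\<dots> \<le> card (S \<times> T)" by (rule card_image_le[OF fin])
    finally have "card W \<le> k * l" using S T by (simp add: card_cartesian_product)
    moreover have "finite W" using fin by (simp add: W_def)
    ultimately show ?thesis by (simp add: ecard_def)
  qed
  finally show ?thesis using k l by simp
qed (use aleph_ge_1[of B "refine X N P f C m"] aleph_ge_1[of B "refine X N P f C n"]
       in \<open>auto simp: one_enat_def zero_enat_def imult_infinity imult_infinity_right\<close>)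

text \<open>
  Compactness of \<open>A\<close> bounds the first refinement, and submultiplicativity then bounds all of them.
\<close>

lemma aleph_refine_finite:
  assumes "open_cover A C"
  shows "aleph B (refine X N P f C n) \<noteq> \<infinity>"
proof (induction n)
  case 0
  have "covers {UNIV} B" by (simp add: covers_def)
  moreover have "{UNIV} \<subseteq> refine X N P f C 0" by (auto simp: mem_refine_iff)
  ultimately have "aleph B (refine X N P f C 0) \<le> ecard {UNIV :: real set}" by (intro aleph_le)
  also have "\<dots> < \<infinity>" by (simp add: ecard_def)
  finally show ?case by simp
next
  case (Suc n)
  obtain C' where C': "C' \<subseteq> C" "finite C'" "A \<subseteq> \<Union>C'"
    using compact_A assms unfolding compact_eq_openin_cover open_cover_def covers_def by meson
  define S where "S = (\<lambda>U. preim X f 0 (U - Disc X N P)) ` C' - {{}}"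
  have "S \<subseteq> refine X N P f C 1"
  proof
    fix V assume "V \<in> S"
    then obtain U where "U \<in> C" "V = preim X f 0 (U - Disc X N P)" "V \<noteq> {}"
      using C'(1) by (auto simp: S_def)
    then show "V \<in> refine X N P f C 1"
      unfolding mem_refine_iff by (intro conjI exI[of _ "\<lambda>_. U"]) auto
  qed
  moreover have "covers S B"
  proof -
    have "x \<in> \<Union>S" if x: "x \<in> B" for x
    proof -
      obtain U where "U \<in> C'" "x \<in> U" using C'(3) B_A x by blast
      moreover have "x \<in> X" "x \<notin> Disc X N P" using x B_A A_X B_Disc by auto
      ultimately have "x \<in> preim X f 0 (U - Disc X N P)" by (simp add: preim_def)
      then show ?thesis using \<open>U \<in> C'\<close> by (auto simp: S_def)
    qed
    then show ?thesis using B_ne by (auto simp: covers_def)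
  qed
  ultimately have "aleph B (refine X N P f C 1) \<le> ecard S" by (rule aleph_le)
  also have "ecard S < \<infinity>" using C'(2) by (simp add: S_def ecard_def)
  finally have "aleph B (refine X N P f C 1) \<noteq> \<infinity>" by simp
  then show ?case
    using aleph_refine_add_le[of 1 C n] Suc.IH by (auto simp: enat_ile)
qed

lemma h_top_cover_eq_growth_rate:
  assumes C: "open_cover A C" and B: "B = A \<inter> Xtilde X N P f"
  shows "h_top_cover X N P f A C = growth_rate (\<lambda>n. aleph B (refine X N P f C n))"
proof -
  have "\<forall>n. \<exists>k. aleph B (refine X N P f C n) = enat k"
    using aleph_refine_finite[OF C] by simp
  then obtain k where k: "aleph B (refine X N P f C n) = enat (k n)" for n by metis
  have k1: "1 \<le> k n" for n
    using aleph_ge_1[of B "refine X N P f C n"] by (simp add: k one_enat_def)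
  have "ln (real (k (m + n))) \<le> ln (real (k m)) + ln (real (k n))" if "0 < m" for m n
  proof -
    have "k (m + n) \<le> k m * k n"
      using aleph_refine_add_le[OF that, of C n] by (simp add: k)
    then have "real (k (m + n)) \<le> real (k m) * real (k n)" by (simp flip: of_nat_mult)
    moreover have "0 < real (k (m + n))" using k1[of "m + n"] by simp
    ultimately have "ln (real (k (m + n))) \<le> ln (real (k m) * real (k n))" by (intro ln_mono)
    also have "\<dots> = ln (real (k m)) + ln (real (k n))"
      using k1[of m] k1[of n] by (simp add: ln_mult_pos)
    finally show ?thesis .
  qed
  moreover have "0 \<le> ln (real (k n))" for n using k1[of n] by simp
  ultimately have "convergent (\<lambda>n. ln (real (k n)) / real n)"
    by (rule Fekete_convergent)
  then obtain L where "(\<lambda>n. ln (real (k n)) / real n) \<longlonglongrightarrow> L" by (auto simp: convergent_def)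
  then have "(\<lambda>n. ereal (ln (real (k n)) / real n)) \<longlonglongrightarrow> ereal L" by simp
  moreover have "\<forall>\<^sub>F n in sequentially. ereal (ln (real (k n)) / real n) =
      eln (aleph B (refine X N P f C n)) / ereal (real n)"
    using eventually_gt_at_top[of 0] by eventually_elim (simp add: k eln_def)
  ultimately have lim: "(\<lambda>n. eln (aleph B (refine X N P f C n)) / ereal (real n)) \<longlonglongrightarrow> ereal L"
    by (rule Lim_transform_eventually)
  show ?thesis
    unfolding h_top_cover_def growth_rate_def B[symmetric]
    using limI[OF lim] lim_imp_Limsup[OF _ lim] by simp
qed


section \<open>Comparison of covers with separated and spanning sets\<close>

text \<open>
  Two points of \<open>B\<close> in the same member of the \<open>n\<close>-th refinement stay close for \<open>n\<close> steps, so each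
  member contains at most one point of a separated set.
\<close>

lemma max_separated_le_aleph:
  assumes small: "\<And>U x y. \<lbrakk>U \<in> C; x \<in> U \<inter> B; y \<in> U \<inter> B\<rbrakk> \<Longrightarrow> d x y < \<epsilon>"
  shows "max_separated d f B \<epsilon> n \<le> aleph B (refine X N P f C n)"
  unfolding max_separated_def aleph_def
proof (intro SUP_least INF_greatest; clarsimp)
  fix E S
  assume E: "separated d f B n \<epsilon> E" and S: "S \<subseteq> refine X N P f C n" and cov: "covers S B"
  have EB: "E \<subseteq> B" using E by (simp add: separated_def)
  have "\<forall>x\<in>E. \<exists>V. V \<in> S \<and> x \<in> V" using cov EB unfolding covers_def by blast
  then obtain g where g: "\<And>x. x \<in> E \<Longrightarrow> g x \<in> S \<and> x \<in> g x" by metis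
  have "inj_on g E"
  proof (rule inj_onI, rule ccontr)
    fix x y assume xy: "x \<in> E" "y \<in> E" "g x = g y" "x \<noteq> y"
    then obtain j where j: "j < n" "\<epsilon> \<le> d ((f ^^ j) x) ((f ^^ j) y)"
      using E unfolding separated_def by blast
    obtain U where U: "\<forall>j<n. U j \<in> C" "g x = (\<Inter>j<n. preim X f j (U j - Disc X N P))"
      using subsetD[OF S, of "g x"] g[OF xy(1)] unfolding mem_refine_iff by blast
    have "(f ^^ j) x \<in> U j \<inter> B" "(f ^^ j) y \<in> U j \<inter> B"
    proof -
      have xyB: "x \<in> B" "y \<in> B" using xy EB by auto
      have "x \<in> g x" "y \<in> g x" using g[OF xy(1)] g[OF xy(2)] xy(3) by auto
      then have "\<forall>j<n. (f ^^ j) x \<in> U j" "\<forall>j<n. (f ^^ j) y \<in> U j"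
        unfolding U(2) mem_itinerary_iff[OF xyB(1)] mem_itinerary_iff[OF xyB(2)] .
      then show "(f ^^ j) x \<in> U j \<inter> B" "(f ^^ j) y \<in> U j \<inter> B"
        using j(1) iter_B xyB by auto
    qed
    then show False using small[of "U j"] U(1) j by force
  qed
  moreover have "g ` E \<subseteq> S" using g by blast
  ultimately show "ecard E \<le> ecard S" by (rule ecard_inj_le)
qed

text \<open>
  Around every point \<open>y\<close> of a spanning set, intersect the preimages of members of \<open>C\<close> that contain
  the \<open>\<epsilon>\<close>-balls about the points \<open>f\<^sup>j y\<close>.
\<close>

lemma aleph_le_min_spanning:
  assumes Lebesgue: "\<And>y. y \<in> B \<Longrightarrow> \<exists>U\<in>C. y \<in> U \<and> (\<forall>x\<in>B. d x y < \<epsilon> \<longrightarrow> x \<in> U)"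
  shows "aleph B (refine X N P f C n) \<le> min_spanning d f B \<epsilon> n"
  unfolding min_spanning_def
proof (intro INF_greatest; clarsimp)
  fix E assume E: "spanning d f B n \<epsilon> E"
  have EB: "E \<subseteq> B" using E by (simp add: spanning_def)
  from Lebesgue obtain u where u: "\<And>y. y \<in> B \<Longrightarrow> u y \<in> C \<and> y \<in> u y"
    and u': "\<And>x y. \<lbrakk>y \<in> B; x \<in> B; d x y < \<epsilon>\<rbrakk> \<Longrightarrow> x \<in> u y" by metis
  define V where "V y = (\<Inter>j<n. preim X f j (u ((f ^^ j) y) - Disc X N P))" for y
  have mem: "y \<in> V y" if "y \<in> B" for y
    unfolding V_def mem_itinerary_iff[OF that] using u[OF iter_B[OF that]] by simp
  have "V ` E \<subseteq> refine X N P f C n"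
  proof
    fix Z assume "Z \<in> V ` E"
    then obtain y where y: "y \<in> B" "Z = V y" using EB by blast
    then have "Z \<noteq> {}" using mem by blast
    moreover have "\<forall>j<n. u ((f ^^ j) y) \<in> C" using u iter_B[OF y(1)] by blast
    ultimately show "Z \<in> refine X N P f C n"
      unfolding mem_refine_iff y(2) V_def
      by (intro conjI exI[of _ "\<lambda>j. u ((f ^^ j) y)"]) auto
  qed
  moreover have "covers (V ` E) B"
  proof -
    have "x \<in> \<Union>(V ` E)" if x: "x \<in> B" for x
    proof -
      obtain y where y: "y \<in> E" "\<forall>j<n. d ((f ^^ j) x) ((f ^^ j) y) < \<epsilon>"
        using E x by (auto simp: spanning_def)
      then have "\<forall>j<n. (f ^^ j) x \<in> u ((f ^^ j) y)"
        using u'[OF iter_B iter_B[OF x]] EB by (simp add: subset_iff)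
      then have "x \<in> V y" unfolding V_def mem_itinerary_iff[OF x] .
      then show ?thesis using y by blast
    qed
    then show ?thesis using B_ne by (auto simp: covers_def)
  qed
  ultimately have "aleph B (refine X N P f C n) \<le> ecard (V ` E)" by (rule aleph_le)
  also have "\<dots> \<le> ecard E" by (rule ecard_image_le)
  finally show "aleph B (refine X N P f C n) \<le> ecard E" .
qed

text \<open>
  The growth rates \<open>R(\<epsilon>)\<close> of spanning sets and \<open>S(\<epsilon>)\<close> of separated sets satisfy \<open>R \<le> S \<le> h\<close>, by
  covers with balls. Conversely, \<open>R\<close> increases as \<open>\<epsilon>\<close> shrinks, and it is at least the entropy of a given
  cover once \<open>\<epsilon>\<close> lies below a Lebesgue number.
\<close>

lemma bowen_formulas_if_uniformly_equivalent:
  assumes B: "B = A \<inter> Xtilde X N P f"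
    and sym: "\<And>x y. \<lbrakk>x \<in> B; y \<in> B\<rbrakk> \<Longrightarrow> d x y = d y x"
    and d_small: "\<And>\<epsilon>. 0 < \<epsilon> \<Longrightarrow> \<exists>\<delta>>0. \<forall>x\<in>B. \<forall>y\<in>B. dist x y < \<delta> \<longrightarrow> d x y < \<epsilon>"
    and dist_small: "\<And>\<epsilon>. 0 < \<epsilon> \<Longrightarrow> \<exists>\<delta>>0. \<forall>x\<in>B. \<forall>y\<in>B. d x y < \<delta> \<longrightarrow> dist x y < \<epsilon>"
  shows "bowen_formulas d f B (h_top X N P f A)"
proof -
  define g where "g C = growth_rate (\<lambda>n. aleph B (refine X N P f C n))" for C
  let ?h = "h_top X N P f A"
  let ?S = "\<lambda>\<epsilon>. growth_rate (max_separated d f B \<epsilon>)"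
  let ?R = "\<lambda>\<epsilon>. growth_rate (min_spanning d f B \<epsilon>)"
  have h: "?h = (SUP C\<in>{C. open_cover A C}. g C)"
    unfolding h_top_def g_def by (rule SUP_cong) (auto simp: h_top_cover_eq_growth_rate[OF _ B])
  have S_le: "?S \<epsilon> \<le> ?h" if "0 < \<epsilon>" for \<epsilon>
  proof -
    obtain \<delta> where \<delta>: "\<delta> > 0" "\<And>x y. \<lbrakk>x \<in> B; y \<in> B; dist x y < \<delta>\<rbrakk> \<Longrightarrow> d x y < \<epsilon>"
      using d_small[OF \<open>0 < \<epsilon>\<close>] by blast
    define C where "C = (\<lambda>z. A \<inter> ball z (\<delta> / 2)) ` A"
    have C: "open_cover A C"
      unfolding open_cover_def covers_def C_def
      using \<delta>(1) B_A B_ne by (auto simp: openin_open_Int)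
    have "max_separated d f B \<epsilon> n \<le> aleph B (refine X N P f C n)" for n
    proof (rule max_separated_le_aleph)
      fix U x y assume U: "U \<in> C" "x \<in> U \<inter> B" "y \<in> U \<inter> B"
      then obtain z where "dist z x < \<delta> / 2" "dist z y < \<delta> / 2" by (auto simp: C_def)
      then have "dist x y < \<delta>" by (rule dist_triangle_half_r)
      then show "d x y < \<epsilon>" using \<delta>(2) U by blast
    qed
    then have "?S \<epsilon> \<le> g C"
      unfolding g_def by (intro growth_rate_mono max_separated_ge_1 B_ne)
    also have "\<dots> \<le> ?h" unfolding h using C by (intro SUP_upper) auto
    finally show ?thesis .
  qed
  have R_le: "?R \<epsilon> \<le> ?S \<epsilon>" if "0 < \<epsilon>" for \<epsilon>
  proof (intro growth_rate_mono min_spanning_ge_1 B_ne min_spanning_le_max_separated f_B sym)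
    show "d x x < \<epsilon>" if "x \<in> B" for x
      using d_small[OF \<open>0 < \<epsilon>\<close>] that by fastforce
  qed
  have R_ge: "\<exists>\<delta>>0. \<forall>\<epsilon>. 0 < \<epsilon> \<and> \<epsilon> < \<delta> \<longrightarrow> g C \<le> ?R \<epsilon>" if C: "open_cover A C" for C
  proof -
    define \<V> where "\<V> = {V. open V \<and> A \<inter> V \<in> C}"
    have "A \<subseteq> \<Union>\<V>"
    proof
      fix x assume "x \<in> A"
      then obtain U where U: "U \<in> C" "x \<in> U" using C by (auto simp: open_cover_def covers_def)
      then obtain V where "open V" "U = A \<inter> V"
        using C by (auto simp: open_cover_def openin_open)
      then show "x \<in> \<Union>\<V>" using U by (auto simp: \<V>_def)
    qed
    moreover have "open V" if "V \<in> \<V>" for V using that by (simp add: \<V>_def)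
    ultimately have "\<exists>e>0. \<forall>y\<in>A. \<exists>V\<in>\<V>. ball y e \<subseteq> V"
      by (rule Heine_Borel_lemma[OF compact_A]) blast+
    then obtain e where e: "e > 0" "\<And>y. y \<in> A \<Longrightarrow> \<exists>V\<in>\<V>. ball y e \<subseteq> V" by blast
    obtain \<delta> where \<delta>: "\<delta> > 0" "\<And>x y. \<lbrakk>x \<in> B; y \<in> B; d x y < \<delta>\<rbrakk> \<Longrightarrow> dist x y < e"
      using dist_small[OF e(1)] by blast
    have Leb: "\<exists>U\<in>C. y \<in> U \<and> (\<forall>x\<in>B. d x y < \<delta> \<longrightarrow> x \<in> U)" if y: "y \<in> B" for y
    proof -
      obtain V where V: "V \<in> \<V>" "ball y e \<subseteq> V" using e(2) y B_A by blast
      have "y \<in> A \<inter> V" using y B_A V(2) e(1) by auto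
      moreover have "x \<in> A \<inter> V" if "x \<in> B" "d x y < \<delta>" for x
        using \<delta>(2)[OF that(1) y that(2)] that V(2) B_A by (auto simp: dist_commute)
      ultimately show ?thesis using V(1) unfolding \<V>_def by blast
    qed
    have "g C \<le> ?R \<epsilon>" if "\<epsilon> < \<delta>" for \<epsilon>
      unfolding g_def
    proof (intro growth_rate_mono aleph_ge_1)
      fix n
      have "aleph B (refine X N P f C n) \<le> min_spanning d f B \<delta> n"
        by (rule aleph_le_min_spanning[OF Leb])
      also have "\<dots> \<le> min_spanning d f B \<epsilon> n" using that by (intro min_spanning_antimono) simp
      finally show "aleph B (refine X N P f C n) \<le> min_spanning d f B \<epsilon> n" .
    qed
    then show ?thesis using \<delta>(1) by blast
  qed
  have R_gt: "\<forall>\<^sub>F \<epsilon> in at_right 0. y < ?R \<epsilon>" if "y < ?h" for y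
  proof -
    obtain C where C: "open_cover A C" "y < g C"
      using \<open>y < ?h\<close> unfolding h less_SUP_iff by auto
    obtain \<delta> where "\<delta> > 0" "\<forall>\<epsilon>. 0 < \<epsilon> \<and> \<epsilon> < \<delta> \<longrightarrow> g C \<le> ?R \<epsilon>" using R_ge[OF C(1)] by blast
    then show ?thesis
      unfolding eventually_at_right_field using C(2) by (intro exI[of _ \<delta>]) (use less_le_trans in blast)
  qed
  have pos: "\<forall>\<^sub>F \<epsilon> in at_right (0::real). 0 < \<epsilon>" by (simp add: eventually_at_right_less)
  show ?thesis
    unfolding bowen_formulas_def
  proof (intro conjI order_tendstoI)
    fix y assume "y < ?h"
    then show "\<forall>\<^sub>F \<epsilon> in at_right 0. y < ?R \<epsilon>" by (rule R_gt)
    show "\<forall>\<^sub>F \<epsilon> in at_right 0. y < ?S \<epsilon>"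
      using R_gt[OF \<open>y < ?h\<close>] pos by eventually_elim (rule less_le_trans[OF _ R_le])
  next
    fix y assume y: "?h < y"
    show "\<forall>\<^sub>F \<epsilon> in at_right 0. ?S \<epsilon> < y"
      using pos by eventually_elim (rule le_less_trans[OF S_le y])
    show "\<forall>\<^sub>F \<epsilon> in at_right 0. ?R \<epsilon> < y"
      using pos by eventually_elim (rule le_less_trans[OF order_trans[OF R_le S_le] y])
  qed
qed

end


section \<open>Compatible metrics\<close>

text \<open>
  The identity is continuous from one metric to the other, hence uniformly continuous by
  compactness.
\<close>

lemma compact_same_topology_uniform:
  assumes M: "Metric_space K d" "Metric_space K d'"
    and top: "Metric_space.mtopology K d = Metric_space.mtopology K d'"
    and comp: "compact_space (Metric_space.mtopology K d)" and "0 < \<epsilon>"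
  shows "\<exists>\<delta>>0. \<forall>x\<in>K. \<forall>y\<in>K. d x y < \<delta> \<longrightarrow> d' x y < \<epsilon>"
proof -
  let ?m = "metric (K, d)" and ?m' = "metric (K, d')"
  have eqs: "mtopology_of ?m = Metric_space.mtopology K d"
    "mtopology_of ?m' = Metric_space.mtopology K d'"
    using M by (simp_all add: mtopology_of_def Metric_space.mspace_metric Metric_space.mdist_metric)
  have "continuous_map (mtopology_of ?m) (mtopology_of ?m') (\<lambda>x. x)"
    unfolding eqs top by simp
  then have "uniformly_continuous_map ?m ?m' (\<lambda>x. x)"
    using continuous_eq_uniformly_continuous_map comp eqs by metis
  then have "\<exists>\<delta>>0. \<forall>x\<in>K. \<forall>y\<in>K. d y x < \<delta> \<longrightarrow> d' y x < \<epsilon>"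
    using \<open>0 < \<epsilon>\<close> M
    by (simp add: uniformly_continuous_map_def Metric_space.mspace_metric Metric_space.mdist_metric)
  then show ?thesis by blast
qed

lemma compatible_metric_dist: "compatible_metric B dist"
proof -
  interpret S: Submetric UNIV dist "closure B"
    by unfold_locales auto
  show ?thesis
    unfolding compatible_metric_def
    using S.sub.Metric_space_axioms S.mtopology_submetric by simp
qed


section \<open>Orbits avoiding the discontinuities\<close>

lemma continuous_outside_Disc:
  assumes pc: "pc_map X N P f" and x: "x \<in> X" "x \<notin> Disc X N P"
  shows "continuous (at x within X) f"
proof -
  have "x \<in> (\<Union>i\<in>{1..N}. (top_of_set X) closure_of (P i))" using pc x(1) by (simp add: pc_map_def)
  then obtain i where i: "i \<in> {1..N}" "x \<in> (top_of_set X) closure_of (P i)" by blast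
  have "x \<notin> (top_of_set X) frontier_of (P i)" using x(2) i(1) by (auto simp: Disc_def)
  then have "x \<in> (top_of_set X) interior_of (P i)" using i(2) by (simp add: frontier_of_def)
  then have xP: "x \<in> P i" by (rule subsetD[OF interior_of_subset])
  have "continuous_on (P i) f" and op: "openin (top_of_set X) (P i)"
    using pc i(1) by (auto simp: pc_map_def)
  then have "continuous (at x within P i) f" using xP by (simp add: continuous_on_eq_continuous_within)
  moreover obtain T where T: "open T" "P i = X \<inter> T" using op by (auto simp: openin_open)
  then have "at x within P i = at x within X"
    using xP by (intro at_within_nhd[of x T]) auto
  ultimately show ?thesis by simp
qed

lemma f_Xtilde:
  assumes "f \<in> X \<rightarrow> X" "x \<in> Xtilde X N P f" shows "f x \<in> Xtilde X N P f"
proof -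
  have *: "x \<in> X \<and> (f ^^ n) x \<in> X - Disc X N P" for n
    using assms(2) by (auto simp: Xtilde_def preim_def)
  have "f x \<in> X \<and> (f ^^ n) (f x) \<in> X - Disc X N P" for n
    using *[of "Suc n"] assms(1) by (auto simp: funpow_swap1)
  then show ?thesis by (auto simp: Xtilde_def preim_def)
qed

text \<open>
  Pseudo-invariance puts a one-sided limit of \<open>f\<close> at \<open>x\<close> into \<open>A\<close>; where \<open>f\<close> is continuous, this limit
  is \<open>f x\<close>.
\<close>

lemma f_inter_Xtilde:
  assumes pc: "pc_map X N P f" and inv: "invariant f A \<or> pseudo_invariant X f A"
  shows "f ` (A \<inter> Xtilde X N P f) \<subseteq> A \<inter> Xtilde X N P f"
proof clarify
  fix x assume x: "x \<in> A" "x \<in> Xtilde X N P f"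
  have "x \<in> preim X f 0 (X - Disc X N P)" using x(2) unfolding Xtilde_def by blast
  then have xX: "x \<in> X" "x \<notin> Disc X N P" by (auto simp: preim_def)
  from inv have "f x \<in> A"
  proof
    assume "invariant f A" then show ?thesis using x(1) by (auto simp: invariant_def)
  next
    assume "pseudo_invariant X f A"
    then obtain F l where F: "F \<in> {at x within (X \<inter> {x<..}), at x within (X \<inter> {..<x})}"
      "F \<noteq> bot" and l: "l \<in> A" "(f \<longlongrightarrow> l) F"
      using x(1) unfolding pseudo_invariant_def by blast
    have "F \<le> at x within X" using F(1) by (auto intro: at_le)
    moreover have "(f \<longlongrightarrow> f x) (at x within X)"
      using continuous_outside_Disc[OF pc xX] by (simp add: continuous_within)
    ultimately have "(f \<longlongrightarrow> f x) F" by (rule tendsto_mono)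
    then have "f x = l" using tendsto_unique F(2) l(2) by blast
    then show ?thesis using l(1) by simp
  qed
  moreover have "f x \<in> Xtilde X N P f"
    using f_Xtilde x(2) pc by (auto simp: pc_map_def)
  ultimately show "f x \<in> A \<inter> Xtilde X N P f" by blast
qed


section \<open>Bowen's formulas\<close>

theorem theorem2p4:
  fixes X A :: "real set" and N :: nat and P :: "nat \<Rightarrow> real set" and f :: "real \<Rightarrow> real"
  assumes "pc_map X N P f"
    and "A \<noteq> {}" and "A \<subseteq> X" and "compact A"
    and "invariant f A \<or> pseudo_invariant X f A"
    and "A \<inter> Xtilde X N P f \<noteq> {}"
  shows "bowen_formulas dist f (A \<inter> Xtilde X N P f) (h_top X N P f A) \<and>
    (\<forall>d. compatible_metric (A \<inter> Xtilde X N P f) d \<longrightarrow>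
       bowen_formulas d f (A \<inter> Xtilde X N P f) (h_top X N P f A))"
proof -
  let ?B = "A \<inter> Xtilde X N P f"
  have "Xtilde X N P f \<subseteq> preim X f 0 (X - Disc X N P)" unfolding Xtilde_def by blast
  then have B_Disc: "?B \<inter> Disc X N P = {}" by (auto simp: preim_def)
  interpret invariant_part X A ?B N P f
  proof
    show "f ` X \<subseteq> X" using assms(1) by (auto simp: pc_map_def)
  qed (use assms B_Disc f_inter_Xtilde in auto)
  have "closure ?B \<subseteq> A" using assms(4) by (intro closure_minimal) (auto intro: compact_imp_closed)
  then have comp: "compact (closure ?B)"
    using assms(4) by (meson bounded_subset closed_closure compact_eq_bounded_closed)
  have bowen: "bowen_formulas d f ?B (h_top X N P f A)" if d: "compatible_metric ?B d" for d
  proof (rule bowen_formulas_if_uniformly_equivalent)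
    note D = d[unfolded compatible_metric_def]
    note E = compatible_metric_dist[of ?B, unfolded compatible_metric_def]
    have sub: "?B \<subseteq> closure ?B" by (rule closure_subset)
    have cs: "compact_space (top_of_set (closure ?B))"
      using comp by (simp add: compact_space_subtopology)
    show "d x y = d y x" for x y
      using D Metric_space.commute by metis
    show "\<exists>\<delta>>0. \<forall>x\<in>?B. \<forall>y\<in>?B. dist x y < \<delta> \<longrightarrow> d x y < \<epsilon>" if "0 < \<epsilon>" for \<epsilon>
      using compact_same_topology_uniform[of "closure ?B" dist d \<epsilon>] D E cs that sub
      by (metis subsetD)
    show "\<exists>\<delta>>0. \<forall>x\<in>?B. \<forall>y\<in>?B. d x y < \<delta> \<longrightarrow> dist x y < \<epsilon>" if "0 < \<epsilon>" for \<epsilon>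
      using compact_same_topology_uniform[of "closure ?B" d dist \<epsilon>] D E cs that sub
      by (metis subsetD)
  qed simp
  then show ?thesis using compatible_metric_dist by blast
qed

end
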